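(* Let $\eta_1,\eta_2,\eta_3>0$ and $\sigma_1,\sigma_2\in\mathbb R$. Let $(\mathbf X(\rho,t),\mu(\rho,t))\in\mathbb V\times\mathbb W$, with $\mathbf X=(\mathbf X_1,\mathbf X_2,\mathbf X_3)$ and $\mu=(\mu_1,\mu_2,\mu_3)$, be a solution of the variational formulation: $\mathbf X(\cdot,0)$ is the given initial datum and for all $t>0$ $$\sum_{j=1}^3\Big[(\partial_t\mathbf X_j\cdot\mathbf n_j,\varphi_j)_{\Gamma_j(t)}+(\partial_{s_j}\mu_j,\partial_{s_j}\varphi_j)_{\Gamma_j(t)}\Big]=0\qquad\forall\,\varphi=(\varphi_1,\varphi_2,\varphi_3)\in\mathbb W,$$ $$\begin{aligned}&\sum_{j=1}^3\Big[(\mu_j\mathbf n_j,\boldsymbol\omega_j)_{\Gamma_j(t)}-(\mathbf Z_{K,j}(\mathbf n_j)\partial_{s_j}\mathbf X_j,\partial_{s_j}\boldsymbol\omega_j)_{\Gamma_j(t)}\Big]-\Big[\tfrac1{\eta_1}\tfrac{dx_A}{dt}+\sigma_1\Big]\omega_{1,1}(0)\\&\quad-\Big[\tfrac1{\eta_2}\tfrac{dx_B}{dt}-\sigma_2\Big]\omega_{2,1}(0)-\Big[\tfrac1{\eta_3}\tfrac{dx_C}{dt}+\sigma_2-\sigma_1\Big]\omega_{3,1}(0)=0\qquad\forall\,\boldsymbol\omega=(\boldsymbol\omega_1,\boldsymbol\omega_2,\boldsymbol\omega_3)\in\mathbb V.\end{aligned}$$ Then the total area $$A(t)=\int_{\Gamma_2(t)}y_2\,\partial_{s_2}x_2\,ds_2-\int_{\Gamma_1(t)}y_1\,\partial_{s_1}x_1\,ds_1$$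 is conserved, $A(t)\equiv A(0)$, and the total energy $$E(t)=\sum_{j=1}^3\int_{\Gamma_j(t)}\gamma_j(\mathbf n_j)\,d\Gamma_j-\sigma_1\big(x_C(t)-x_A(t)\big)-\sigma_2\big(x_B(t)-x_C(t)\big)$$ is dissipative, $E(t_1)\le E(t_2)\le E(0)$ for all $t_1\ge t_2\ge0$.
   Context: Notation. $\mathbb S^1$ is the unit circle in $\mathbb R^2$, $(a,b)^\perp=(b,-a)$, and $\mathbb I_j=[0,1]$ for $j=1,2,3$. The curve $\Gamma_j(t)$ is parameterized by $\rho_j\in\mathbb I_j\mapsto\mathbf X_j(\rho_j,t)=(x_j,y_j)$; $s_j$ is its arc length, so $\partial_{s_j}=|\partial_{\rho_j}\mathbf X_j|^{-1}\partial_{\rho_j}$ and $\partial_{\rho_j}s_j=|\partial_{\rho_j}\mathbf X_j|$; $\partial_t$ is taken at fixed $\rho_j$. $\boldsymbol\tau_j=\partial_{s_j}\mathbf X_j$ and $\mathbf n_j=-\boldsymbol\tau_j^\perp$. Contact points: $x_A(t)=x_1(0,t)$, $x_B(t)=x_2(0,t)$, $x_C(t)=x_3(0,t)$. The inner product is $(u,v)_{\Gamma_j(t)}=\int_{\mathbb I_j}u\cdot v\,\partial_{\rho_j}s_j\,d\rho_j$ for scalar or $\mathbb R^2$-valued $u,v$. Surface energy. $\gamma_j\in C^2(\mathbb S^1)$, $\gamma_j>0$; $\widehat\gamma_j(\mathbf p)=|\mathbf p|\gamma_j(\mathbf p/|\mathbf p|)$ for $\mathbf p\neq\mathbf0$;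 $\boldsymbol\xi_j(\mathbf n)=\nabla\widehat\gamma_j(\mathbf p)|_{\mathbf p=\mathbf n}$. With a given non-negative stabilizing function $K_j:\mathbb S^1\to[0,\infty)$ and the $2\times2$ identity $\mathbf I_2$, the symmetric surface energy matrix is $$\mathbf Z_{K,j}(\mathbf n)=\gamma_j(\mathbf n)\mathbf I_2-\mathbf n\,\boldsymbol\xi_j(\mathbf n)^\top-\boldsymbol\xi_j(\mathbf n)\,\mathbf n^\top+K_j(\mathbf n)\,\mathbf n\mathbf n^\top,\qquad\mathbf n\in\mathbb S^1.$$ Function spaces. With $H^1(\mathbb I_j)$ the usual Sobolev space and $\mathbf H^1(\mathbb I_j)=H^1(\mathbb I_j)^2$, $$\mathbb V=\Big\{(\mathbf v_1,\mathbf v_2,\mathbf v_3)\in\prod_{j=1}^3\mathbf H^1(\mathbb I_j):\ \mathbf v_j=(v_{j,1},v_{j,2}),\ v_{j,2}(0)=0\ (j=1,2,3),\ \mathbf v_1(1)=\mathbf v_2(1)=\mathbf v_3(1)\Big\},$$ $$\mathbb W=\Big\{(\chi_1,\chi_2,\chi_3)\in\prod_{j=1}^3H^1(\mathbb I_j):\ \sum_{j=1}^3\chi_j(1)=0\Big\}.$$ Likewise $\boldsymbol\omega_j=(\omega_{j,1},\omega_{j,2})$. The solution is understood to be regular enough (regular curves, and sufficiently smooth in $\rho_j$ and $t$, with $\partial_t\mathbf X(\cdot,t)\in\mathbb V$) for all expressions to make sense and for $A$ and $E$ to be differentiated under the integral sign. *)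

theory Defs
  imports "HOL-Analysis.Analysis"
begin

section \<open>Plane curves parameterized over the unit interval\<close>

definition perp :: "real^2 \<Rightarrow> real^2" where
  "perp v = vector [v $ 2, - (v $ 1)]"

text \<open>The derivative in the parameter is one-sided at 0 and 1.\<close>

definition d_rho :: "(real \<Rightarrow> 'a::real_normed_vector) \<Rightarrow> real \<Rightarrow> 'a" where
  "d_rho f r = vector_derivative f (at r within {0..1})"

definition speed :: "(real \<Rightarrow> real^2) \<Rightarrow> real \<Rightarrow> real" where
  "speed c r = norm (d_rho c r)"

text \<open>\<open>per_arclength c g\<close> turns a (classical or weak) derivative \<open>g\<close> in the parameter
  into the derivative with respect to the arc length of \<open>c\<close>.\<close>

definition per_arclength ::
    "(real \<Rightarrow> real^2) \<Rightarrow> (real \<Rightarrow> 'a::real_normed_vector) \<Rightarrow> real \<Rightarrow> 'a" where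
  "per_arclength c g r = inverse (speed c r) *\<^sub>R g r"

definition d_s :: "(real \<Rightarrow> real^2) \<Rightarrow> (real \<Rightarrow> 'a::real_normed_vector) \<Rightarrow> real \<Rightarrow> 'a" where
  "d_s c f = per_arclength c (d_rho f)"

definition tangent :: "(real \<Rightarrow> real^2) \<Rightarrow> real \<Rightarrow> real^2" where
  "tangent c = d_s c c"

definition normal :: "(real \<Rightarrow> real^2) \<Rightarrow> real \<Rightarrow> real^2" where
  "normal c r = - perp (tangent c r)"

definition curve_integral :: "(real \<Rightarrow> real^2) \<Rightarrow> (real \<Rightarrow> real) \<Rightarrow> real" where
  "curve_integral c f = (LINT r:{0..1}|lebesgue. f r * speed c r)"

definition curve_inner ::
    "(real \<Rightarrow> real^2) \<Rightarrow> (real \<Rightarrow> 'a::real_inner) \<Rightarrow> (real \<Rightarrow> 'a) \<Rightarrow> real" where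
  "curve_inner c u v = curve_integral c (\<lambda>r. u r \<bullet> v r)"

section \<open>Anisotropic surface energy\<close>

text \<open>Functions on the unit circle are total functions on the plane of which only the values
  on \<open>sphere 0 1\<close> are used; \<open>C\<^sup>2\<close> regularity on the circle is regularity in the angle.\<close>

definition C2_on_circle :: "(real^2 \<Rightarrow> real) \<Rightarrow> bool" where
  "C2_on_circle g \<longleftrightarrow>
     (let h = (\<lambda>\<theta>. g (vector [cos \<theta>, sin \<theta>])) in
       (\<forall>\<theta>. h differentiable (at \<theta>)) \<and> (\<forall>\<theta>. deriv h differentiable (at \<theta>)) \<and>
       continuous_on UNIV (deriv (deriv h)))"

definition hom_ext :: "(real^2 \<Rightarrow> real) \<Rightarrow> real^2 \<Rightarrow> real" where
  "hom_ext g p = norm p * g (p /\<^sub>R norm p)"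

definition gradient :: "('a::real_inner \<Rightarrow> real) \<Rightarrow> 'a \<Rightarrow> 'a" where
  "gradient f x = (THE D. GDERIV f x :> D)"

definition xi_vec :: "(real^2 \<Rightarrow> real) \<Rightarrow> real^2 \<Rightarrow> real^2" where
  "xi_vec g n = gradient (hom_ext g) n"

definition outer :: "real^2 \<Rightarrow> real^2 \<Rightarrow> real^2^2" where
  "outer u v = (\<chi> i k. u $ i * v $ k)"

definition Z_matrix :: "(real^2 \<Rightarrow> real) \<Rightarrow> (real^2 \<Rightarrow> real) \<Rightarrow> real^2 \<Rightarrow> real^2^2" where
  "Z_matrix g K n =
     g n *\<^sub>R mat 1 - outer n (xi_vec g n) - outer (xi_vec g n) n + K n *\<^sub>R outer n n"

section \<open>Sobolev spaces on the unit interval\<close>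

definition test_function :: "(real \<Rightarrow> real) \<Rightarrow> bool" where
  "test_function \<phi> \<longleftrightarrow>
     (\<forall>k x. (deriv ^^ k) \<phi> differentiable (at x)) \<and>
     (\<exists>a b. 0 < a \<and> b < 1 \<and> (\<forall>x. x \<notin> {a..b} \<longrightarrow> \<phi> x = 0))"

definition L2_unit :: "(real \<Rightarrow> 'a::euclidean_space) \<Rightarrow> bool" where
  "L2_unit g \<longleftrightarrow> set_borel_measurable lebesgue {0..1} g \<and>
     set_integrable lebesgue {0..1} (\<lambda>r. (norm (g r))\<^sup>2)"

text \<open>\<open>g\<close> is a square-integrable weak derivative of \<open>f\<close>. It is determined only up to null sets,
  hence a relation. For vector-valued functions it says the same of each component.\<close>

definition has_weak_derivative ::
    "(real \<Rightarrow> 'a::euclidean_space) \<Rightarrow> (real \<Rightarrow> 'a) \<Rightarrow> bool" where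
  "has_weak_derivative f g \<longleftrightarrow> L2_unit g \<and>
     (\<forall>\<phi>. test_function \<phi> \<longrightarrow>
        (LINT r:{0..1}|lebesgue. deriv \<phi> r *\<^sub>R f r) = - (LINT r:{0..1}|lebesgue. \<phi> r *\<^sub>R g r))"

text \<open>Elements of \<open>H\<^sup>1\<close> are represented by their continuous representative on the closed interval,
  so that end-point values are traces.\<close>

definition H1_unit :: "(real \<Rightarrow> 'a::euclidean_space) set" where
  "H1_unit = {f. continuous_on {0..1} f \<and> L2_unit f \<and> (\<exists>g. has_weak_derivative f g)}"

text \<open>The three curves are indexed by the type \<open>3\<close>, whose elements are \<open>1\<close>, \<open>2\<close> and \<open>3\<close>
  (with \<open>3 = 0\<close>).\<close>

definition V_space :: "(3 \<Rightarrow> real \<Rightarrow> real^2) set" where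
  "V_space = {v. (\<forall>j. v j \<in> H1_unit) \<and> (\<forall>j. v j 0 $ 2 = 0) \<and> v 1 1 = v 2 1 \<and> v 2 1 = v 3 1}"

definition W_space :: "(3 \<Rightarrow> real \<Rightarrow> real) set" where
  "W_space = {\<psi>. (\<forall>j. \<psi> j \<in> H1_unit) \<and> (\<Sum>j\<in>UNIV. \<psi> j 1) = 0}"

section \<open>Evolving curves\<close>

text \<open>\<open>X r t\<close> is the position at parameter \<open>r\<close> and time \<open>t\<close>; \<open>slice X t\<close> is the curve at time \<open>t\<close>.\<close>

definition slice :: "(real \<Rightarrow> real \<Rightarrow> 'a) \<Rightarrow> real \<Rightarrow> real \<Rightarrow> 'a" where
  "slice X t = (\<lambda>r. X r t)"

definition d_t :: "(real \<Rightarrow> real \<Rightarrow> 'a::real_normed_vector) \<Rightarrow> real \<Rightarrow> real \<Rightarrow> 'a" where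
  "d_t X r t = vector_derivative (X r) (at t)"

text \<open>Regular curves up to and including the initial time, with continuous first and mixed second
  derivatives at positive times: this is what differentiating length-type integrals under the
  integral sign requires.\<close>

definition regular_evolution :: "(real \<Rightarrow> real \<Rightarrow> real^2) \<Rightarrow> bool" where
  "regular_evolution X \<longleftrightarrow>
     (\<forall>t\<ge>0. \<forall>r\<in>{0..1}. slice X t differentiable (at r within {0..1}) \<and>
        d_rho (slice X t) r \<noteq> 0) \<and>
     continuous_on ({0..1} \<times> {0..}) (\<lambda>(r, t). X r t) \<and>
     continuous_on ({0..1} \<times> {0..}) (\<lambda>(r, t). d_rho (slice X t) r) \<and>
     (\<forall>t>0. \<forall>r\<in>{0..1}. X r differentiable (at t) \<and>
        (\<lambda>t'. d_rho (slice X t') r) differentiable (at t) \<and>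
        slice (d_t X) t differentiable (at r within {0..1})) \<and>
     continuous_on ({0..1} \<times> {0<..}) (\<lambda>(r, t). d_t X r t) \<and>
     continuous_on ({0..1} \<times> {0<..}) (\<lambda>(r, t). d_t (\<lambda>r' t'. d_rho (slice X t') r') r t) \<and>
     continuous_on ({0..1} \<times> {0<..}) (\<lambda>(r, t). d_rho (slice (d_t X) t) r)"

text \<open>The abscissas of the contact points A, B, C are \<open>contact X 1\<close>, \<open>contact X 2\<close>,
  \<open>contact X 3\<close>.\<close>

definition contact :: "(3 \<Rightarrow> real \<Rightarrow> real \<Rightarrow> real^2) \<Rightarrow> 3 \<Rightarrow> real \<Rightarrow> real" where
  "contact X j t = X j 0 t $ 1"

definition area_under :: "(real \<Rightarrow> real^2) \<Rightarrow> real" where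
  "area_under c = curve_integral c (\<lambda>r. c r $ 2 * d_s c (\<lambda>r'. c r' $ 1) r)"

definition total_area :: "(3 \<Rightarrow> real \<Rightarrow> real \<Rightarrow> real^2) \<Rightarrow> real \<Rightarrow> real" where
  "total_area X t = area_under (slice (X 2) t) - area_under (slice (X 1) t)"

definition total_energy ::
    "(3 \<Rightarrow> real^2 \<Rightarrow> real) \<Rightarrow> real \<Rightarrow> real \<Rightarrow> (3 \<Rightarrow> real \<Rightarrow> real \<Rightarrow> real^2) \<Rightarrow> real \<Rightarrow> real" where
  "total_energy \<gamma> \<sigma>1 \<sigma>2 X t =
     (\<Sum>j\<in>UNIV. curve_integral (slice (X j) t) (\<lambda>r. \<gamma> j (normal (slice (X j) t) r)))
     - \<sigma>1 * (contact X 3 t - contact X 1 t) - \<sigma>2 * (contact X 2 t - contact X 3 t)"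

end

theory Submission
  imports Defs
begin

text \<open>Testing the first equation with \<open>\<phi> = (1, -1, 0)\<close> equates the normal fluxes through
  \<open>\<Gamma>\<^sub>1\<close> and \<open>\<Gamma>\<^sub>2\<close>; integration by parts shows that the difference of these fluxes is the derivative
  of the area, as the boundary terms vanish on the substrate and cancel at the triple point.
  For the energy, write the density as \<open>hom_ext \<gamma> (- perp (d_rho X))\<close>, so that its time derivative is
  \<open>\<xi>(n) \<bullet> (- perp (d_rho (d_t X)))\<close>. By Euler's identity \<open>\<xi>(n) \<bullet> n = \<gamma>(n)\<close> this equals
  \<open>(Z \<tau>) \<bullet> d_rho (d_t X)\<close>, and testing with \<open>\<phi> = \<mu>\<close> and \<open>\<omega> = d_t X\<close> leaves minus a sum of
  squares. Both quantities are differentiated for positive times only; continuity extends the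
  conclusions to time 0.\<close>

section \<open>The homogeneous extension of the surface energy\<close>

lemma perp_component [simp]: "perp v $ 1 = v $ 2" "perp v $ 2 = - (v $ 1)"
  by (simp_all add: perp_def)

lemma bounded_linear_perp: "bounded_linear perp"
  by (rule linear_conv_bounded_linear[THEN iffD1], rule linearI)
     (simp_all add: vec_eq_iff forall_2)

lemma perp_scaleR: "perp (c *\<^sub>R v) = c *\<^sub>R perp v"
  by (simp add: vec_eq_iff forall_2)

lemma norm_perp [simp]: "norm (perp v) = norm v"
  by (simp add: norm_eq_sqrt_inner inner_vec_def sum_2 algebra_simps)

lemma perp_eq_0_iff [simp]: "perp v = 0 \<longleftrightarrow> v = 0"
  by (metis norm_eq_zero norm_perp)

text \<open>The stabilizing term \<open>K\<close> drops out because it acts only on the normal direction; the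
  rotated tangent and Euler's identity turn the matrix into the gradient of the extension.\<close>

lemma Z_matrix_tangent:
  assumes \<tau>: "norm \<tau> = 1" and euler: "xi_vec g (- perp \<tau>) \<bullet> (- perp \<tau>) = g (- perp \<tau>)"
  shows "(Z_matrix g K (- perp \<tau>) *v \<tau>) \<bullet> w = xi_vec g (- perp \<tau>) \<bullet> (- perp w)"
proof -
  define \<xi> where "\<xi> = xi_vec g (- perp \<tau>)"
  define G where "G = g (- perp \<tau>)"
  have 1: "\<tau> $ 1 * \<tau> $ 1 + \<tau> $ 2 * \<tau> $ 2 = 1"
    using \<tau> by (simp add: norm_eq_sqrt_inner inner_vec_def sum_2)
  \<comment> \<open>Euler's identity in coordinates. As the normal is orthogonal to \<tau>, only two
    terms of the matrix survive on \<tau>; eliminating \<open>G\<close> from them leaves the squared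
    length of \<tau> as a common factor.\<close>
  have G: "G = \<xi> $ 2 * \<tau> $ 1 - \<xi> $ 1 * \<tau> $ 2"
    using euler by (simp add: \<xi>_def G_def inner_vec_def sum_2)
  have "(Z_matrix g K (- perp \<tau>) *v \<tau>) \<bullet> w =
     G * (\<tau> \<bullet> w) - (- perp \<tau> \<bullet> w) * (\<xi> \<bullet> \<tau>)"
    by (simp add: Z_matrix_def \<xi>_def[symmetric] G_def[symmetric] outer_def matrix_vector_mult_def
          inner_vec_def sum_2 mat_def algebra_simps)
  also have "\<dots> = (\<tau> $ 1 * \<tau> $ 1 + \<tau> $ 2 * \<tau> $ 2) * (\<xi> \<bullet> (- perp w))"
    by (simp add: G inner_vec_def sum_2 algebra_simps)
  finally show ?thesis
    by (simp add: 1 \<xi>_def)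
qed

section \<open>Gradient of the one-homogeneous extension\<close>

lemma GDERIV_unique: "GDERIV f x :> D \<Longrightarrow> GDERIV f x :> D' \<Longrightarrow> D = D'"
  unfolding gderiv_def
  by (drule (1) has_derivative_unique, subst (asm) fun_eq_iff) (metis inner_commute vector_eq_rdot)

lemma gradient_eqI: "GDERIV f x :> D \<Longrightarrow> gradient f x = D"
  unfolding gradient_def by (blast intro: GDERIV_unique)

text \<open>One-homogeneity: dividing the argument by \<open>s\<close> and multiplying the value by
  \<open>s\<close> changes nothing, and the two factors cancel in the chain rule. So the gradient is
  constant along rays.\<close>

lemma GDERIV_hom_ext_scaleR:
  assumes D: "GDERIV (hom_ext g) p :> D" and s: "s > 0"
  shows "GDERIV (hom_ext g) (s *\<^sub>R p) :> D"
proof -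
  have *: "hom_ext g = (\<lambda>q. s * hom_ext g (q /\<^sub>R s))"
    using s by (simp add: hom_ext_def fun_eq_iff field_simps)
  have "(hom_ext g has_derivative (\<lambda>v. v \<bullet> D)) (at ((s *\<^sub>R p) /\<^sub>R s))"
    using D s by (simp add: gderiv_def)
  then have "((\<lambda>q. hom_ext g (q /\<^sub>R s)) has_derivative (\<lambda>v. (v /\<^sub>R s) \<bullet> D)) (at (s *\<^sub>R p))"
    by (rule has_derivative_compose[rotated]) (auto intro!: derivative_eq_intros)
  then have "((\<lambda>q. s * hom_ext g (q /\<^sub>R s)) has_derivative (\<lambda>v. s * ((v /\<^sub>R s) \<bullet> D))) (at (s *\<^sub>R p))"
    by (rule has_derivative_mult_right)
  then show ?thesis
    unfolding gderiv_def using s by (subst *) (simp flip: mult.assoc)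
qed

text \<open>On the half-plane around \<open>p0\<close>, the polar angle is \<open>\<theta>0 + arctan (b p / a p)\<close> with \<open>(a p, b p)\<close>
  the coordinates of \<open>p\<close> in the frame rotated by the angle \<open>\<theta>0\<close> of \<open>p0\<close>; there the extension is
  \<open>norm p * h (\<theta> p)\<close>.\<close>

lemma hom_ext_C1_local:
  assumes g: "C2_on_circle g" and p0: "p0 \<noteq> 0"
  obtains U D where "open U" "p0 \<in> U" "continuous_on U D"
    "\<And>p. p \<in> U \<Longrightarrow> GDERIV (hom_ext g) p :> D p" "\<And>p. p \<in> U \<Longrightarrow> D p \<bullet> p = hom_ext g p"
proof -
  define h where "h = (\<lambda>\<theta>. g (vector [cos \<theta>, sin \<theta>]))"
  have h: "(h has_real_derivative deriv h \<theta>) (at \<theta>)" for \<theta>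
    using g unfolding C2_on_circle_def h_def[symmetric] Let_def
    by (simp add: DERIV_deriv_iff_real_differentiable)
  have cont_h': "continuous_on UNIV (deriv h)"
    using g unfolding C2_on_circle_def h_def[symmetric] Let_def
    by (auto intro!: differentiable_imp_continuous_on simp: differentiable_on_def)
  have cont_h: "continuous_on UNIV h"
    using h DERIV_isCont by (auto simp: continuous_on_eq_continuous_at)
  have "(p0 $ 1 / norm p0)\<^sup>2 + (p0 $ 2 / norm p0)\<^sup>2 = 1"
    using p0 by (simp add: power_divide norm_eq_sqrt_inner inner_vec_def sum_2 power2_eq_square
        flip: add_divide_distrib) (auto simp: vec_eq_iff forall_2 sum_squares_eq_zero_iff)
  then obtain \<theta>0 where \<theta>0: "p0 $ 1 / norm p0 = cos \<theta>0" "p0 $ 2 / norm p0 = sin \<theta>0"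
    by (metis sincos_total_2pi)
  define a b where "a = (\<lambda>p::real^2. cos \<theta>0 * p $ 1 + sin \<theta>0 * p $ 2)"
    and "b = (\<lambda>p::real^2. cos \<theta>0 * p $ 2 - sin \<theta>0 * p $ 1)"
  define \<theta> where "\<theta> = (\<lambda>p. \<theta>0 + arctan (b p / a p))"
  define U where "U = {p. 0 < a p}"
  \<comment> \<open>The expected gradient of \<open>norm p * h (\<theta> p)\<close>: the radial part
    differentiates the norm, and the part along \<open>- perp p\<close> comes from the gradient
    \<open>- perp p / (norm p)^2\<close> of the angle.\<close>
  define D where "D = (\<lambda>p. (h (\<theta> p) / norm p) *\<^sub>R p + (deriv h (\<theta> p) / norm p) *\<^sub>R (- perp p))"
  \<comment> \<open>This sum is carried as an explicit factor below, which makes each rotation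
    formula a polynomial identity; only afterwards is it replaced by 1.\<close>
  have cs: "cos \<theta>0 * cos \<theta>0 + sin \<theta>0 * sin \<theta>0 = 1"
    using sin_cos_squared_add3 by blast
  have ab: "(a p)\<^sup>2 + (b p)\<^sup>2 = (norm p)\<^sup>2" for p
  proof -
    have n: "(norm p)\<^sup>2 = p $ 1 * p $ 1 + p $ 2 * p $ 2"
      by (simp add: power2_norm_eq_inner inner_vec_def sum_2)
    have "(a p)\<^sup>2 + (b p)\<^sup>2 = (cos \<theta>0 * cos \<theta>0 + sin \<theta>0 * sin \<theta>0) * (norm p)\<^sup>2"
      unfolding n unfolding power2_eq_square
      by (simp add: a_def b_def algebra_simps del: sin_cos_squared_add3)
    then show ?thesis by (simp add: cs)
  qed
  have cont_a: "continuous_on S a" "continuous_on S b" for S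
    unfolding a_def b_def by (intro continuous_intros)+
  have "open U"
    unfolding U_def by (intro open_Collect_less continuous_on_const cont_a)
  have "p0 \<in> U"
  proof -
    have "p0 $ 1 = norm p0 * cos \<theta>0" "p0 $ 2 = norm p0 * sin \<theta>0"
      using \<theta>0 p0 by (simp_all add: field_simps)
    then have "a p0 = norm p0 * (cos \<theta>0 * cos \<theta>0 + sin \<theta>0 * sin \<theta>0)"
      by (simp add: a_def algebra_simps del: sin_cos_squared_add3)
    then show ?thesis using p0 by (simp add: cs U_def)
  qed
  have "0 \<notin> U" by (simp add: U_def a_def)
  have "continuous_on U D"
  proof -
    have "continuous_on U \<theta>"
      unfolding \<theta>_def by (intro continuous_intros cont_a) (auto simp: U_def)
    moreover have "norm p \<noteq> 0" if "p \<in> U" for p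
      using that \<open>0 \<notin> U\<close> by auto
    ultimately show ?thesis
      unfolding D_def
      by (intro continuous_intros continuous_on_compose2[OF cont_h] continuous_on_compose2[OF cont_h']
          bounded_linear.continuous_on[OF bounded_linear_perp]) auto
  qed
  have hom: "hom_ext g p = norm p * h (\<theta> p)" if "p \<in> U" for p
  proof -
    have a: "a p > 0" using that by (simp add: U_def)
    \<comment> \<open>The secant of the angle relative to \<theta>0; it turns the formulas for
      cosine and sine of \<open>arctan\<close> into \<open>a p / norm p\<close> and
      \<open>b p / norm p\<close>.\<close>
    have "1 + (b p / a p)\<^sup>2 = (norm p / a p)\<^sup>2"
      using a by (simp add: power_divide field_simps flip: ab)
    then have s: "sqrt (1 + (b p / a p)\<^sup>2) = norm p / a p"
      using a by simp
    have np: "norm p > 0" using that \<open>0 \<notin> U\<close> by auto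
    have c: "cos (arctan (b p / a p)) = a p / norm p" "sin (arctan (b p / a p)) = b p / norm p"
      using a np by (simp_all add: cos_arctan sin_arctan s)
    have 1: "cos \<theta>0 * a p - sin \<theta>0 * b p = (cos \<theta>0 * cos \<theta>0 + sin \<theta>0 * sin \<theta>0) * p $ 1"
      "sin \<theta>0 * a p + cos \<theta>0 * b p = (cos \<theta>0 * cos \<theta>0 + sin \<theta>0 * sin \<theta>0) * p $ 2"
      by (simp_all add: a_def b_def algebra_simps del: sin_cos_squared_add3)
    have "cos (\<theta> p) = (cos \<theta>0 * a p - sin \<theta>0 * b p) / norm p"
      "sin (\<theta> p) = (sin \<theta>0 * a p + cos \<theta>0 * b p) / norm p"
      by (simp_all add: \<theta>_def cos_add sin_add c diff_divide_distrib add_divide_distrib)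
    then have "vector [cos (\<theta> p), sin (\<theta> p)] = p /\<^sub>R norm p"
      by (simp add: 1 cs vec_eq_iff forall_2 divide_inverse mult.commute)
    then show ?thesis by (simp add: hom_ext_def h_def)
  qed
  have "GDERIV (hom_ext g) p :> D p" if "p \<in> U" for p
  proof -
    have a: "a p > 0" using that by (simp add: U_def)
    have np: "p \<noteq> 0" using that \<open>0 \<notin> U\<close> by auto
    have da: "(a has_derivative a) (at p)" "(b has_derivative b) (at p)"
      unfolding a_def b_def by (auto intro!: derivative_eq_intros bounded_linear.has_derivative[OF bounded_linear_vec_nth])
    have "(\<theta> has_derivative (\<lambda>v. (b v * a p - b p * a v) / (norm p)\<^sup>2)) (at p)"
    proof -
      have "((\<lambda>p. b p / a p) has_derivative (\<lambda>v. (b v * a p - b p * a v) / (a p * a p))) (at p)"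
        using a by (intro has_derivative_divide' da) auto
      then have "((\<lambda>p. arctan (b p / a p)) has_derivative
          (\<lambda>v. ((b v * a p - b p * a v) / (a p * a p)) * inverse (1 + (b p / a p)\<^sup>2))) (at p)"
        by (rule DERIV_compose_FDERIV[OF DERIV_arctan])
      moreover have "x / (a p * a p) * inverse (1 + (b p / a p)\<^sup>2) = x / (norm p)\<^sup>2" for x
        using a ab[of p] by (simp add: power_divide field_simps power2_eq_square)
      ultimately have "((\<lambda>p. arctan (b p / a p)) has_derivative
          (\<lambda>v. (b v * a p - b p * a v) / (norm p)\<^sup>2)) (at p)"
        by (simp only:)
      from has_derivative_add[OF has_derivative_const[of \<theta>0] this] show ?thesis
        by (simp add: \<theta>_def)
    qed
    \<comment> \<open>A determinant of two vectors, hence independent of the rotated frame.\<close>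
    moreover have "b v * a p - b p * a v = v \<bullet> (- perp p)" for v
    proof -
      have "b v * a p - b p * a v = (cos \<theta>0 * cos \<theta>0 + sin \<theta>0 * sin \<theta>0) * (v \<bullet> (- perp p))"
        by (simp add: a_def b_def inner_vec_def sum_2 algebra_simps del: sin_cos_squared_add3)
      then show ?thesis by (simp add: cs)
    qed
    ultimately have "(\<theta> has_derivative (\<lambda>v. (v \<bullet> (- perp p)) / (norm p)\<^sup>2)) (at p)"
      by simp
    then have "((\<lambda>p. h (\<theta> p)) has_derivative (\<lambda>v. (v \<bullet> (- perp p)) / (norm p)\<^sup>2 * deriv h (\<theta> p))) (at p)"
      by (rule DERIV_compose_FDERIV[OF h])
    then have "((\<lambda>p. norm p * h (\<theta> p)) has_derivative
        (\<lambda>v. norm p * ((v \<bullet> (- perp p)) / (norm p)\<^sup>2 * deriv h (\<theta> p)) + (v \<bullet> sgn p) * h (\<theta> p))) (at p)"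
      by (rule has_derivative_mult[OF has_derivative_norm[OF np]])
    moreover have "norm p * ((v \<bullet> (- perp p)) / (norm p)\<^sup>2 * deriv h (\<theta> p)) + (v \<bullet> sgn p) * h (\<theta> p) = v \<bullet> D p" for v
      using np by (simp add: D_def inner_add_right inner_diff_right sgn_div_norm power2_eq_square field_simps inner_commute)
    ultimately have "((\<lambda>p. norm p * h (\<theta> p)) has_derivative (\<lambda>v. v \<bullet> D p)) (at p)"
      by simp
    then show ?thesis
      unfolding gderiv_def
      by (rule has_derivative_transform_within_open[OF _ \<open>open U\<close> that]) (simp add: hom)
  qed
  moreover have "D p \<bullet> p = hom_ext g p" if "p \<in> U" for p
  proof -
    have "p \<noteq> 0" using that \<open>0 \<notin> U\<close> by auto
    \<comment> \<open>Only the radial part of \<open>D p\<close> contributes to Euler's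
      identity.\<close>
    moreover have "perp p \<bullet> p = 0" by (simp add: inner_vec_def sum_2)
    ultimately show ?thesis
      by (simp add: D_def hom[OF that] inner_add_left inner_diff_left dot_square_norm power2_eq_square)
  qed
  ultimately show ?thesis
    using \<open>open U\<close> \<open>p0 \<in> U\<close> \<open>continuous_on U D\<close> by (intro that)
qed

text \<open>Uniqueness of derivatives identifies the locally built field with
  \<open>gradient\<close>, so its two properties hold at every nonzero point.\<close>

lemma hom_ext_gradient:
  assumes "C2_on_circle g" "p \<noteq> 0"
  shows GDERIV_hom_ext: "GDERIV (hom_ext g) p :> gradient (hom_ext g) p"
    and inner_gradient_hom_ext: "gradient (hom_ext g) p \<bullet> p = hom_ext g p"
  by (metis hom_ext_C1_local[OF assms] gradient_eqI)+

text \<open>Continuity is local, and near each nonzero point \<open>gradient\<close> agrees with a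
  continuous field.\<close>

lemma continuous_on_gradient_hom_ext:
  assumes "C2_on_circle g"
  shows "continuous_on (- {0}) (gradient (hom_ext g))"
proof (rule continuous_at_imp_continuous_on, rule ballI)
  fix p :: "real^2" assume "p \<in> - {0}"
  then have "p \<noteq> 0" by simp
  from hom_ext_C1_local[OF assms this] obtain U D where U: "open U" "p \<in> U" "continuous_on U D"
    "\<And>p. p \<in> U \<Longrightarrow> GDERIV (hom_ext g) p :> D p" by metis
  have "continuous_on U (gradient (hom_ext g))"
    using U(3) by (rule continuous_on_eq) (metis gradient_eqI U(4))
  then show "isCont (gradient (hom_ext g)) p"
    using U by (simp add: continuous_on_eq_continuous_at)
qed

text \<open>Connects the vector in the energy matrix, evaluated at the unit normal, with the
  gradient at the unnormalized normal that appears when the energy is differentiated.\<close>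

lemma gradient_hom_ext_normalize:
  assumes "C2_on_circle g" "p \<noteq> 0"
  shows "xi_vec g (p /\<^sub>R norm p) = gradient (hom_ext g) p"
  unfolding xi_vec_def
  using GDERIV_hom_ext_scaleR[OF GDERIV_hom_ext[OF assms], of "inverse (norm p)"] assms(2)
  by (simp add: gradient_eqI)

section \<open>Calculus on the unit interval\<close>

lemma LINT_eq_integral:
  fixes f :: "real \<Rightarrow> 'a::euclidean_space"
  assumes "continuous_on {a..b} f"
  shows "(LINT r:{a..b}|lebesgue. f r) = integral {a..b} f"
  by (intro set_lebesgue_integral_eq_integral absolutely_integrable_continuous_real assms)

lemma LINT_unit_cong:
  "(\<And>r. r \<in> {0..1} \<Longrightarrow> f r = g r) \<Longrightarrow>
    (LINT r:{0..1::real}|lebesgue. f r) = (LINT r:{0..1}|lebesgue. g r)"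
  by (rule set_lebesgue_integral_cong) auto

lemma L2_unit_continuous:
  fixes f :: "real \<Rightarrow> 'a::euclidean_space"
  assumes "continuous_on {0..1} f"
  shows "L2_unit f"
proof -
  have "set_integrable lebesgue {0..1} f" "set_integrable lebesgue {0..1} (\<lambda>r. (norm (f r))\<^sup>2)"
    by (intro absolutely_integrable_continuous_real continuous_intros assms)+
  then show ?thesis
    by (simp add: L2_unit_def set_borel_measurable_def set_integrable_def borel_measurable_integrable)
qed

text \<open>Integration by parts; the boundary terms vanish because test functions are supported
  inside the open interval. It supplies the weak derivatives of the test functions inserted into the
  variational equations.\<close>

lemma has_weak_derivative_classical:
  fixes f :: "real \<Rightarrow> 'a::euclidean_space"
  assumes f: "\<And>r. r \<in> {0..1} \<Longrightarrow> (f has_vector_derivative f' r) (at r within {0..1})"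
    and f': "continuous_on {0..1} f'"
  shows "has_weak_derivative f f'"
  unfolding has_weak_derivative_def
proof (intro conjI allI impI L2_unit_continuous f')
  fix \<phi> assume "test_function \<phi>"
  then obtain a b where d: "\<And>k x. (deriv ^^ k) \<phi> differentiable (at x)"
    and ab: "0 < a" "b < 1" "\<And>x. x \<notin> {a..b} \<Longrightarrow> \<phi> x = 0"
    unfolding test_function_def by blast
  have \<phi>: "(\<phi> has_real_derivative deriv \<phi> x) (at x)" for x
    using d[of 0 x] by (simp add: DERIV_deriv_iff_real_differentiable)
  have "continuous_on {0..1} (deriv \<phi>)"
    using d[of 1] by (auto intro!: differentiable_imp_continuous_on differentiable_at_imp_differentiable_on)
  moreover have "continuous_on {0..1} \<phi>"
    using \<phi> by (auto intro!: continuous_at_imp_continuous_on DERIV_isCont)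
  moreover have "continuous_on {0..1} f"
    using f has_vector_derivative_continuous continuous_on_eq_continuous_within by blast
  ultimately have c: "continuous_on {0..1} (\<lambda>r. deriv \<phi> r *\<^sub>R f r)"
    "continuous_on {0..1} (\<lambda>r. \<phi> r *\<^sub>R f' r)"
    by (auto intro!: continuous_intros f')
  have "((\<lambda>r. \<phi> r *\<^sub>R f r) has_vector_derivative (\<phi> r *\<^sub>R f' r + deriv \<phi> r *\<^sub>R f r)) (at r within {0..1})"
    if "r \<in> {0..1}" for r
    using that by (intro has_vector_derivative_scaleR f has_field_derivative_at_within[OF \<phi>])
  then have "((\<lambda>r. \<phi> r *\<^sub>R f' r + deriv \<phi> r *\<^sub>R f r) has_integral \<phi> 1 *\<^sub>R f 1 - \<phi> 0 *\<^sub>R f 0) {0..1}"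
    by (intro fundamental_theorem_of_calculus) auto
  moreover have "\<phi> 0 = 0" "\<phi> 1 = 0"
    using ab by auto
  ultimately have "integral {0..1} (\<lambda>r. \<phi> r *\<^sub>R f' r + deriv \<phi> r *\<^sub>R f r) = 0"
    by (simp add: integral_unique)
  then have "integral {0..1} (\<lambda>r. \<phi> r *\<^sub>R f' r) + integral {0..1} (\<lambda>r. deriv \<phi> r *\<^sub>R f r) = 0"
    by (subst (asm) integral_add) (auto intro!: integrable_continuous_real c)
  then show "(LINT r:{0..1}|lebesgue. deriv \<phi> r *\<^sub>R f r) = - (LINT r:{0..1}|lebesgue. \<phi> r *\<^sub>R f' r)"
    by (simp add: LINT_eq_integral c eq_neg_iff_add_eq_0 add.commute)
qed

lemma H1_unit_const: "(\<lambda>r. c) \<in> H1_unit"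
  by (auto simp: H1_unit_def intro!: L2_unit_continuous exI[of _ "\<lambda>r. 0"] has_weak_derivative_classical)

section \<open>Integrals depending on time and exchange of derivatives\<close>

lemma has_real_derivative_integral_param:
  fixes f f' :: "real \<Rightarrow> real \<Rightarrow> real"
  assumes f: "\<And>r t. r \<in> {a..b} \<Longrightarrow> t > 0 \<Longrightarrow> (f r has_real_derivative f' r t) (at t)"
    and f': "continuous_on ({a..b} \<times> {0<..}) (\<lambda>(r, t). f' r t)"
    and cont: "\<And>t. t > 0 \<Longrightarrow> continuous_on {a..b} (\<lambda>r. f r t)"
    and t: "t > 0"
  shows "((\<lambda>t. integral {a..b} (\<lambda>r. f r t)) has_real_derivative integral {a..b} (\<lambda>r. f' r t)) (at t)"
proof -
  have "((\<lambda>t. integral (cbox a b) (\<lambda>r. f r t)) has_real_derivative integral (cbox a b) (\<lambda>r. f' r t))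
      (at t within {0<..})"
  proof (rule leibniz_rule_field_derivative)
    show "continuous_on ({0<..} \<times> cbox a b) (\<lambda>(x, r). f' r x)"
      using continuous_on_compose2[OF f' continuous_on_swap, of "{0<..} \<times> {a..b}"]
      by (simp add: split_beta prod.swap_def image_subset_iff)
  qed (use t f cont in \<open>auto intro!: integrable_continuous_real intro: has_field_derivative_at_within\<close>)
  then show ?thesis
    using t by (simp add: at_within_open[of t "{0<..}"])
qed

lemma continuous_on_integral_param:
  fixes f :: "real \<Rightarrow> real \<Rightarrow> real"
  assumes f: "continuous_on ({a..b} \<times> S) (\<lambda>(r, t). f r t)"
  shows "continuous_on S (\<lambda>t. integral {a..b} (\<lambda>r. f r t))"
proof -
  have "continuous_on (S \<times> cbox a b) (\<lambda>(x, r). f r x)"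
    using continuous_on_compose2[OF f continuous_on_swap, of "S \<times> {a..b}"]
    by (simp add: split_beta prod.swap_def image_subset_iff)
  from integral_continuous_on_param[OF this] show ?thesis by simp
qed

lemma continuous_on_slice1:
  assumes "continuous_on (A \<times> B) (\<lambda>(r, t). f r t)" "t \<in> B"
  shows "continuous_on A (\<lambda>r. f r t)"
  using continuous_on_compose2[OF assms(1), of A "\<lambda>r. (r, t)"] assms(2)
  by (simp add: image_subset_iff continuous_on_Pair)

lemma continuous_on_slice2:
  assumes "continuous_on (A \<times> B) (\<lambda>(r, t). f r t)" "r \<in> A"
  shows "continuous_on B (\<lambda>t. f r t)"
  using continuous_on_compose2[OF assms(1), of B "\<lambda>t. (r, t)"] assms(2)
  by (simp add: image_subset_iff continuous_on_Pair)

text \<open>Neither mixed derivative is assumed to come from a \<open>C\<^sup>2\<close> function of two variables, and \<open>r\<close> may be an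
  end point, so the increment of \<open>fr\<close> in time is computed by differentiating under the integral.\<close>

lemma mixed_derivatives_eq:
  fixes f :: "real \<Rightarrow> real \<Rightarrow> 'a::euclidean_space"
  assumes fr: "\<And>r t. r \<in> {0..1} \<Longrightarrow> t > 0 \<Longrightarrow> ((\<lambda>r. f r t) has_vector_derivative fr r t) (at r within {0..1})"
    and ft: "\<And>r t. r \<in> {0..1} \<Longrightarrow> t > 0 \<Longrightarrow> (f r has_vector_derivative ft r t) (at t)"
    and frt: "\<And>r t. r \<in> {0..1} \<Longrightarrow> t > 0 \<Longrightarrow> (fr r has_vector_derivative frt r t) (at t)"
    and ftr: "\<And>r t. r \<in> {0..1} \<Longrightarrow> t > 0 \<Longrightarrow> ((\<lambda>r. ft r t) has_vector_derivative ftr r t) (at r within {0..1})"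
    and cont_ft: "continuous_on ({0..1} \<times> {0<..}) (\<lambda>(r, t). ft r t)"
    and cont_ftr: "continuous_on ({0..1} \<times> {0<..}) (\<lambda>(r, t). ftr r t)"
    and r: "r \<in> {0..1}" and t: "t > 0"
  shows "frt r t = ftr r t"
proof -
  \<comment> \<open>A base time strictly between 0 and \<open>t\<close>, so that
    \<open>{a..u}\<close> stays within the positive times, where the derivatives are
    controlled.\<close>
  define a where "a = t / 2"
  have a: "0 < a" "a < t" using t by (auto simp: a_def)
  have cont: "continuous_on {a..u} (ft s)" "continuous_on {a..u} (ftr s)" if "s \<in> {0..1}" for s u
    using continuous_on_slice2[OF cont_ft that] continuous_on_slice2[OF cont_ftr that] a
    by (auto elim!: continuous_on_subset)
  have eq: "fr r u - fr r a = integral {a..u} (ftr r)" if u: "u \<ge> a" for u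
  proof -
    have "((\<lambda>s. integral (cbox a u) (ft s)) has_vector_derivative integral (cbox a u) (ftr r))
        (at r within {0..1})"
    proof (rule leibniz_rule_vector_derivative)
      show "continuous_on ({0..1} \<times> cbox a u) (\<lambda>(x, t). ftr x t)"
        using a by (intro continuous_on_subset[OF cont_ftr]) auto
    qed (use a r ftr cont in \<open>auto intro!: integrable_continuous_real\<close>)
    moreover have "f s u - f s a = integral (cbox a u) (ft s)" if "s \<in> {0..1}" for s
      using ft[OF that] a
      by (intro integral_unique[symmetric] fundamental_theorem_of_calculus[unfolded box_real[symmetric]] u)
         (auto intro: has_vector_derivative_at_within)
    ultimately have "((\<lambda>s. f s u - f s a) has_vector_derivative integral (cbox a u) (ftr r))
        (at r within {0..1})"
      by (rule has_vector_derivative_transform[OF r, rotated])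
    moreover have "((\<lambda>s. f s u - f s a) has_vector_derivative fr r u - fr r a) (at r within {0..1})"
      using a u r by (intro has_vector_derivative_diff fr) auto
    \<comment> \<open>Both sides are derivatives in the parameter of \<open>f s u - f s a\<close> at
      \<open>r\<close>; one-sided derivatives on a nondegenerate interval are unique, end points
      included.\<close>
    ultimately show ?thesis
      using vector_derivative_within_closed_interval[of 0 1 r] r by (metis box_real(2) zero_less_one)
  qed
  \<comment> \<open>The interval reaches beyond \<open>t\<close>, which makes \<open>t\<close>
    interior, and starts at \<open>a\<close>, as the increment formula holds only for
    \<open>u \<ge> a\<close>.\<close>
  have "((\<lambda>u. integral {a..u} (ftr r)) has_vector_derivative ftr r t) (at t within {a..t + 1})"
    using a by (intro integral_has_vector_derivative cont r) auto
  then have "((\<lambda>u. fr r u - fr r a) has_vector_derivative ftr r t) (at t within {a..t + 1})"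
    using a by (elim has_vector_derivative_transform[rotated 2]) (auto simp: eq)
  moreover have "((\<lambda>u. fr r u - fr r a) has_vector_derivative frt r t - 0) (at t within {a..t + 1})"
    using frt[OF r t] by (intro has_vector_derivative_diff) (auto intro: has_vector_derivative_at_within)
  ultimately have "ftr r t = frt r t - 0"
    using a by (intro vector_derivative_within_closed_interval[of a "t + 1" t, THEN sym, THEN trans,
          OF _ _ _ vector_derivative_within_closed_interval]) auto
  then show ?thesis by simp
qed

section \<open>Area and surface energy of an evolving curve\<close>

context
  fixes X :: "real \<Rightarrow> real \<Rightarrow> real^2"
  assumes X: "regular_evolution X"
begin

section \<open>Derivatives of one evolving curve and their continuity\<close>

lemma slice_regular:
  assumes "t \<ge> 0" "r \<in> {0..1}"
  shows slice_has_vector_derivative: "((\<lambda>r. X r t) has_vector_derivative d_rho (slice X t) r) (at r within {0..1})"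
    and d_rho_nonzero: "d_rho (slice X t) r \<noteq> 0"
  using X assms unfolding regular_evolution_def d_rho_def slice_def
  by (auto simp flip: vector_derivative_works)

lemma time_has_vector_derivative:
  assumes "t > 0" "r \<in> {0..1}"
  shows "(X r has_vector_derivative d_t X r t) (at t)"
  using X assms unfolding regular_evolution_def d_t_def
  by (auto simp flip: vector_derivative_works)

lemma velocity_has_vector_derivative:
  assumes "t > 0" "r \<in> {0..1}"
  shows "((\<lambda>r. d_t X r t) has_vector_derivative d_rho (slice (d_t X) t) r) (at r within {0..1})"
  using X assms unfolding regular_evolution_def d_rho_def slice_def
  by (auto simp flip: vector_derivative_works)

text \<open>Exchanges the derivatives, so that rates of change of \<open>d_rho\<close> are expressed
  by the velocity, which is the test function used later.\<close>

lemma d_rho_has_vector_derivative: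
  assumes t: "t > 0" and r: "r \<in> {0..1}"
  shows "((\<lambda>t. d_rho (slice X t) r) has_vector_derivative d_rho (slice (d_t X) t) r) (at t)"
proof -
  let ?frt = "d_t (\<lambda>r t. d_rho (slice X t) r)"
  have *: "((\<lambda>t. d_rho (slice X t) r) has_vector_derivative ?frt r t) (at t)"
    if "t > 0" "r \<in> {0..1}" for r t
    using X that unfolding regular_evolution_def d_t_def
    by (auto simp flip: vector_derivative_works)
  have "?frt r t = d_rho (slice (d_t X) t) r"
    by (rule mixed_derivatives_eq[where f = X and ft = "d_t X" and fr = "\<lambda>r t. d_rho (slice X t) r"
          and ftr = "\<lambda>r t. d_rho (slice (d_t X) t) r"])
      (use X t r in \<open>auto intro: slice_has_vector_derivative time_has_vector_derivative
        velocity_has_vector_derivative * simp: regular_evolution_def\<close>)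
  then show ?thesis
    using *[OF t r] by simp
qed

lemma regular_evolution_continuous:
  shows "continuous_on ({0..1} \<times> {0..}) (\<lambda>x. X (fst x) (snd x))"
    and "continuous_on ({0..1} \<times> {0..}) (\<lambda>x. d_rho (slice X (snd x)) (fst x))"
    and "continuous_on ({0..1} \<times> {0<..}) (\<lambda>x. d_t X (fst x) (snd x))"
    and "continuous_on ({0..1} \<times> {0<..}) (\<lambda>x. d_rho (slice (d_t X) (snd x)) (fst x))"
  using X by (auto simp: regular_evolution_def split_beta)

lemma regular_evolution_continuous_pos:
  shows "continuous_on ({0..1} \<times> {0<..}) (\<lambda>x. X (fst x) (snd x))"
    and "continuous_on ({0..1} \<times> {0<..}) (\<lambda>x. d_rho (slice X (snd x)) (fst x))"
  by (rule continuous_on_subset[OF regular_evolution_continuous(1)]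
        continuous_on_subset[OF regular_evolution_continuous(2)]; auto)+

lemma slice_continuous:
  assumes "t \<ge> 0"
  shows "continuous_on {0..1} (\<lambda>r. X r t)"
    and "continuous_on {0..1} (d_rho (slice X t))"
  using continuous_on_slice1[of "{0..1}" "{0..}" X t] regular_evolution_continuous(1)
    continuous_on_slice1[of "{0..1}" "{0..}" "\<lambda>r t. d_rho (slice X t) r" t]
    regular_evolution_continuous(2) assms
  by (simp_all add: split_beta)

lemma slice_velocity_continuous:
  assumes "t > 0"
  shows "continuous_on {0..1} (\<lambda>r. d_t X r t)"
    and "continuous_on {0..1} (d_rho (slice (d_t X) t))"
  using continuous_on_slice1[of "{0..1}" "{0<..}" "d_t X" t] regular_evolution_continuous(3)
    continuous_on_slice1[of "{0..1}" "{0<..}" "\<lambda>r t. d_rho (slice (d_t X) t) r" t]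
    regular_evolution_continuous(4) assms
  by (simp_all add: split_beta)

lemma has_weak_derivative_velocity:
  assumes "t > 0"
  shows "has_weak_derivative (slice (d_t X) t) (d_rho (slice (d_t X) t))"
proof (rule has_weak_derivative_classical)
  show "continuous_on {0..1} (d_rho (slice (d_t X) t))"
    by (rule slice_velocity_continuous[OF assms])
qed (use velocity_has_vector_derivative[OF assms] in \<open>simp add: slice_def\<close>)

lemma normal_speed:
  assumes "t \<ge> 0" "r \<in> {0..1}"
  shows "speed (slice X t) r *\<^sub>R normal (slice X t) r = - perp (d_rho (slice X t) r)"
  using d_rho_nonzero[OF assms]
  by (simp add: normal_def tangent_def d_s_def per_arclength_def speed_def perp_scaleR)

section \<open>Area under one curve\<close>

lemma area_under_slice:
  assumes t: "t \<ge> 0"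
  shows "area_under (slice X t) = integral {0..1} (\<lambda>r. X r t $ 2 * d_rho (slice X t) r $ 1)"
proof -
  have "d_rho (\<lambda>r'. slice X t r' $ 1) r = d_rho (slice X t) r $ 1" if r: "r \<in> {0..1}" for r
  proof -
    have "((\<lambda>r'. slice X t r' $ 1) has_vector_derivative d_rho (slice X t) r $ 1) (at r within {0..1})"
      using bounded_linear.has_vector_derivative[OF bounded_linear_vec_nth
          slice_has_vector_derivative[OF t r]] by (simp add: slice_def)
    then show ?thesis
      unfolding d_rho_def using r vector_derivative_within_closed_interval[of 0 1 r] by auto
  qed
  then have "area_under (slice X t) = (LINT r:{0..1}|lebesgue. X r t $ 2 * d_rho (slice X t) r $ 1)"
    using d_rho_nonzero[OF t] unfolding area_under_def curve_integral_def
    by (intro LINT_unit_cong) (simp add: d_s_def per_arclength_def speed_def slice_def)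
  also have "\<dots> = integral {0..1} (\<lambda>r. X r t $ 2 * d_rho (slice X t) r $ 1)"
    using t by (intro LINT_eq_integral continuous_intros slice_continuous)
  finally show ?thesis .
qed

lemma continuous_on_area_under: "continuous_on {0..} (\<lambda>t. area_under (slice X t))"
proof -
  have "continuous_on {0..} (\<lambda>t. integral {0..1} (\<lambda>r. X r t $ 2 * d_rho (slice X t) r $ 1))"
    by (intro continuous_on_integral_param)
      (auto simp: split_beta intro!: continuous_intros regular_evolution_continuous)
  then show ?thesis
    by (rule continuous_on_eq) (simp add: area_under_slice)
qed

text \<open>With x, y the coordinates, the integrand y x_r has time derivative y x_rt + y_t x_r.
  Integrating the first term by parts leaves y_t x_r - y_r x_t, the normal velocity times the speed,
  and the boundary values of y x_t, of which the one at parameter 0 is zero.\<close>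

lemma area_under_has_derivative:
  assumes t: "t > 0" and bd: "X 0 t $ 2 = 0"
  shows "((\<lambda>t. area_under (slice X t)) has_real_derivative
    curve_integral (slice X t) (\<lambda>r. d_t X r t \<bullet> normal (slice X t) r) + X 1 t $ 2 * d_t X 1 t $ 1) (at t)"
proof -
  define c where "c = slice X t"
  let ?v = "\<lambda>r. d_t X r t" and ?v' = "d_rho (slice (d_t X) t)"
  let ?f' = "\<lambda>r t. X r t $ 2 * d_rho (slice (d_t X) t) r $ 1 + d_t X r t $ 2 * d_rho (slice X t) r $ 1"
  let ?g = "\<lambda>r. ?v r \<bullet> (- perp (d_rho c r))"
  have cont: "continuous_on ({0..1} \<times> {0<..}) (\<lambda>(r, t). ?f' r t)"
    by (auto simp: split_beta intro!: continuous_intros regular_evolution_continuous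
        regular_evolution_continuous_pos)
  have "((\<lambda>t. integral {0..1} (\<lambda>r. X r t $ 2 * d_rho (slice X t) r $ 1)) has_real_derivative
      integral {0..1} (\<lambda>r. ?f' r t)) (at t)"
  proof (rule has_real_derivative_integral_param[OF _ cont _ t])
    show "((\<lambda>t. X r t $ 2 * d_rho (slice X t) r $ 1) has_real_derivative ?f' r t) (at t)"
      if "r \<in> {0..1}" "t > 0" for r t
      using bounded_linear.has_vector_derivative[OF bounded_linear_vec_nth[of 2] time_has_vector_derivative[OF that(2,1)]]
        bounded_linear.has_vector_derivative[OF bounded_linear_vec_nth[of 1] d_rho_has_vector_derivative[OF that(2,1)]]
      by (auto intro!: derivative_eq_intros simp: has_real_derivative_iff_has_vector_derivative[symmetric])
    show "continuous_on {0..1} (\<lambda>r. X r t $ 2 * d_rho (slice X t) r $ 1)" if "t > 0" for t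
      using that by (intro continuous_intros slice_continuous) simp_all
  qed
  then have "((\<lambda>t. area_under (slice X t)) has_real_derivative integral {0..1} (\<lambda>r. ?f' r t)) (at t)"
    using t by (elim has_field_derivative_transform_within_open[where S = "{0<..}"])
      (auto simp: area_under_slice)
  moreover have "integral {0..1} (\<lambda>r. ?f' r t) =
      curve_integral (slice X t) (\<lambda>r. d_t X r t \<bullet> normal (slice X t) r) + X 1 t $ 2 * d_t X 1 t $ 1"
  proof -
    have g: "continuous_on {0..1} ?g"
      unfolding c_def using t
      by (intro continuous_intros slice_continuous slice_velocity_continuous
          bounded_linear.continuous_on[OF bounded_linear_perp]) simp_all
    have "((\<lambda>r. X r t $ 2 * ?v r $ 1) has_vector_derivative
        (X r t $ 2 * ?v' r $ 1 + d_rho c r $ 2 * ?v r $ 1)) (at r within {0..1})" if "r \<in> {0..1}" for r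
      using bounded_linear.has_vector_derivative[OF bounded_linear_vec_nth[of 2] slice_has_vector_derivative[of t r]]
        bounded_linear.has_vector_derivative[OF bounded_linear_vec_nth[of 1] velocity_has_vector_derivative[of t r]] t that
      by (auto intro!: derivative_eq_intros
          simp: has_real_derivative_iff_has_vector_derivative[symmetric] c_def)
    then have "((\<lambda>r. X r t $ 2 * ?v' r $ 1 + d_rho c r $ 2 * ?v r $ 1) has_integral
        X 1 t $ 2 * ?v 1 $ 1 - X 0 t $ 2 * ?v 0 $ 1) {0..1}"
      by (intro fundamental_theorem_of_calculus) auto
    moreover have "(?g has_integral integral {0..1} ?g) {0..1}"
      using g by (intro integrable_integral integrable_continuous_real)
    ultimately have "((\<lambda>r. ?g r + (X r t $ 2 * ?v' r $ 1 + d_rho c r $ 2 * ?v r $ 1)) has_integral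
        (integral {0..1} ?g + (X 1 t $ 2 * ?v 1 $ 1 - X 0 t $ 2 * ?v 0 $ 1))) {0..1}"
      by (intro has_integral_add)
    then have "integral {0..1} (\<lambda>r. ?f' r t) = integral {0..1} ?g + X 1 t $ 2 * ?v 1 $ 1"
      by (intro integral_unique) (simp add: bd c_def inner_vec_def sum_2 algebra_simps)
    also have "integral {0..1} ?g = curve_integral c (\<lambda>r. ?v r \<bullet> normal c r)"
      unfolding curve_integral_def LINT_eq_integral[OF g, symmetric]
      using t normal_speed[of t, folded c_def]
      by (intro LINT_unit_cong) (simp flip: inner_scaleR_right inner_minus_right add: mult.commute)
    finally show ?thesis by (simp add: c_def)
  qed
  ultimately show ?thesis by simp
qed

section \<open>Anisotropic surface energy of one curve\<close>

context
  fixes g :: "real^2 \<Rightarrow> real"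
  assumes g: "C2_on_circle g"
begin

lemma continuous_on_hom_ext: "continuous_on (- {0}) (hom_ext g)"
  using GDERIV_hom_ext[OF g] has_derivative_continuous
  by (fastforce simp: gderiv_def intro!: continuous_at_imp_continuous_on)

lemma continuous_on_energy_density:
  "continuous_on ({0..1} \<times> {0..}) (\<lambda>x. hom_ext g (- perp (d_rho (slice X (snd x)) (fst x))))"
  by (rule continuous_on_compose2[OF continuous_on_hom_ext])
    (auto intro!: continuous_intros regular_evolution_continuous
      bounded_linear.continuous_on[OF bounded_linear_perp] simp: d_rho_nonzero)

lemma slice_energy_density_continuous:
  "t \<ge> 0 \<Longrightarrow> continuous_on {0..1} (\<lambda>r. hom_ext g (- perp (d_rho (slice X t) r)))"
  using continuous_on_slice1[of "{0..1}" "{0..}" "\<lambda>r t. hom_ext g (- perp (d_rho (slice X t) r))" t]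
    continuous_on_energy_density
  by (simp add: split_beta)

text \<open>The norm in the extension absorbs the arc-length factor, leaving an integrand that
  depends on \<open>d_rho\<close> alone.\<close>

lemma surface_energy_slice:
  assumes t: "t \<ge> 0"
  shows "curve_integral (slice X t) (\<lambda>r. g (normal (slice X t) r)) =
    integral {0..1} (\<lambda>r. hom_ext g (- perp (d_rho (slice X t) r)))"
proof -
  from LINT_eq_integral[OF slice_energy_density_continuous[OF t], symmetric] show ?thesis
    unfolding curve_integral_def
    by (simp add: hom_ext_def normal_def tangent_def d_s_def per_arclength_def speed_def perp_scaleR
        mult.commute)
qed

lemma continuous_on_surface_energy:
  "continuous_on {0..} (\<lambda>t. curve_integral (slice X t) (\<lambda>r. g (normal (slice X t) r)))"
proof -
  have "continuous_on {0..} (\<lambda>t. integral {0..1} (\<lambda>r. hom_ext g (- perp (d_rho (slice X t) r))))"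
    using continuous_on_energy_density by (intro continuous_on_integral_param) (simp add: split_beta)
  then show ?thesis
    by (rule continuous_on_eq) (simp add: surface_energy_slice)
qed

text \<open>The rate is put in exactly the form of the matrix term of the second variational
  equation tested with the velocity.\<close>

lemma surface_energy_has_derivative:
  assumes t: "t > 0"
  shows "((\<lambda>t. curve_integral (slice X t) (\<lambda>r. g (normal (slice X t) r))) has_real_derivative
    curve_inner (slice X t) (\<lambda>r. Z_matrix g K (normal (slice X t) r) *v d_s (slice X t) (slice X t) r)
      (per_arclength (slice X t) (d_rho (slice (d_t X) t)))) (at t)"
proof -
  let ?q = "\<lambda>r t. - perp (d_rho (slice X t) r)"
  let ?f' = "\<lambda>r t. gradient (hom_ext g) (?q r t) \<bullet> (- perp (d_rho (slice (d_t X) t) r))"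
  have cont: "continuous_on ({0..1} \<times> {0<..}) (\<lambda>(r, t). ?f' r t)"
  proof -
    have "continuous_on ({0..1} \<times> {0<..}) (\<lambda>x. gradient (hom_ext g) (?q (fst x) (snd x)))"
      by (rule continuous_on_compose2[OF continuous_on_gradient_hom_ext[OF g]])
        (auto intro!: continuous_intros regular_evolution_continuous_pos
          bounded_linear.continuous_on[OF bounded_linear_perp] simp: d_rho_nonzero)
    then show ?thesis
      by (auto simp: split_beta intro!: continuous_intros regular_evolution_continuous
          bounded_linear.continuous_on[OF bounded_linear_perp])
  qed
  have "((\<lambda>t. integral {0..1} (\<lambda>r. hom_ext g (?q r t))) has_real_derivative
      integral {0..1} (\<lambda>r. ?f' r t)) (at t)"
  proof (rule has_real_derivative_integral_param[OF _ cont _ t])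
    show "((\<lambda>t. hom_ext g (?q r t)) has_real_derivative ?f' r t) (at t)" if r: "r \<in> {0..1}" and t: "t > 0" for r t
    proof -
      have "((\<lambda>t. ?q r t) has_vector_derivative - perp (d_rho (slice (d_t X) t) r)) (at t)"
        using d_rho_has_vector_derivative[OF t r]
        by (intro has_vector_derivative_minus bounded_linear.has_vector_derivative[OF bounded_linear_perp])
      moreover have "GDERIV (hom_ext g) (?q r t) :> gradient (hom_ext g) (?q r t)"
        using d_rho_nonzero[of t r] r t by (intro GDERIV_hom_ext[OF g]) auto
      ultimately show ?thesis
        unfolding has_real_derivative_iff_has_vector_derivative gderiv_def
        using vector_derivative_diff_chain_within[OF _ has_derivative_at_withinI]
        by (fastforce simp: o_def inner_commute)
    qed
    show "continuous_on {0..1} (\<lambda>r. hom_ext g (?q r t))" if "t > 0" for t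
      using that by (intro slice_energy_density_continuous) simp
  qed
  then have "((\<lambda>t. curve_integral (slice X t) (\<lambda>r. g (normal (slice X t) r))) has_real_derivative
      integral {0..1} (\<lambda>r. ?f' r t)) (at t)"
    using t by (elim has_field_derivative_transform_within_open[where S = "{0<..}"])
      (auto simp: surface_energy_slice)
  moreover have "integral {0..1} (\<lambda>r. ?f' r t) = curve_inner (slice X t)
      (\<lambda>r. Z_matrix g K (normal (slice X t) r) *v d_s (slice X t) (slice X t) r)
      (per_arclength (slice X t) (d_rho (slice (d_t X) t)))"
  proof -
    define c where "c = slice X t"
    \<comment> \<open>The speed cancels the factor hidden in \<open>per_arclength\<close>, and
      constancy of the gradient along rays permits passing to the unit normal.\<close>
    have "?f' r t = (Z_matrix g K (normal c r) *v d_s c c r) \<bullet>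
        per_arclength c (d_rho (slice (d_t X) t)) r * speed c r" if r: "r \<in> {0..1}" for r
    proof -
      have nz: "d_rho c r \<noteq> 0"
        unfolding c_def using t r d_rho_nonzero by simp
      have n: "normal c r = - perp (d_rho c r) /\<^sub>R norm (- perp (d_rho c r))"
        by (simp add: normal_def tangent_def d_s_def per_arclength_def speed_def perp_scaleR)
      have \<xi>: "xi_vec g (normal c r) = gradient (hom_ext g) (- perp (d_rho c r))"
        unfolding n using nz by (intro gradient_hom_ext_normalize[OF g]) simp
      have nn: "normal c r \<noteq> 0" "norm (normal c r) = 1"
        using nz by (auto simp: n)
      \<comment> \<open>On unit vectors the extension coincides with \<open>g\<close>, which gives
        Euler's identity in the form the matrix lemma asks for.\<close>
      have "xi_vec g (normal c r) \<bullet> normal c r = g (normal c r)"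
        using inner_gradient_hom_ext[OF g nn(1)] nn(2) by (simp add: xi_vec_def hom_ext_def)
      then have "(Z_matrix g K (normal c r) *v d_s c c r) \<bullet> w = xi_vec g (normal c r) \<bullet> (- perp w)" for w
        using nn(2) unfolding normal_def tangent_def by (intro Z_matrix_tangent) simp_all
      then show ?thesis
        using nz by (simp add: \<xi> per_arclength_def perp_scaleR speed_def flip: c_def)
    qed
    moreover have "continuous_on {0..1} (\<lambda>r. ?f' r t)"
      using continuous_on_slice1[OF cont] t by simp
    ultimately show ?thesis
      unfolding curve_inner_def curve_integral_def c_def[symmetric]
      by (subst LINT_eq_integral[symmetric]) (auto intro!: LINT_unit_cong)
  qed
  ultimately show ?thesis by simp
qed

end

end

section \<open>Conservation and dissipation\<close>

theorem proposition3p1: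
  fixes \<gamma> K :: "3 \<Rightarrow> real^2 \<Rightarrow> real"
    and \<eta> :: "3 \<Rightarrow> real"
    and \<sigma>1 \<sigma>2 :: real
    and X0 :: "3 \<Rightarrow> real \<Rightarrow> real^2"
    and X :: "3 \<Rightarrow> real \<Rightarrow> real \<Rightarrow> real^2"
    and \<mu> :: "3 \<Rightarrow> real \<Rightarrow> real \<Rightarrow> real"
  assumes gamma_C2: "\<And>j. C2_on_circle (\<gamma> j)"
    and gamma_pos: "\<And>j n. n \<in> sphere 0 1 \<Longrightarrow> \<gamma> j n > 0"
    and K_nonneg: "\<And>j n. n \<in> sphere 0 1 \<Longrightarrow> K j n \<ge> 0"
    and eta_pos: "\<And>j. \<eta> j > 0"
    and regular: "\<And>j. regular_evolution (X j)"
    and X_in_V: "\<And>t. t \<ge> 0 \<Longrightarrow> (\<lambda>j. slice (X j) t) \<in> V_space"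
    and dtX_in_V: "\<And>t. t > 0 \<Longrightarrow> (\<lambda>j. slice (d_t (X j)) t) \<in> V_space"
    and mu_in_W: "\<And>t. t > 0 \<Longrightarrow> (\<lambda>j. slice (\<mu> j) t) \<in> W_space"
    and initial: "\<And>j r. r \<in> {0..1} \<Longrightarrow> X j r 0 = X0 j r"
    and weak_velocity:
      "\<And>t \<mu>' \<phi> \<phi>'.
        t > 0 \<Longrightarrow> (\<And>j. has_weak_derivative (slice (\<mu> j) t) (\<mu>' j)) \<Longrightarrow>
        \<phi> \<in> W_space \<Longrightarrow> (\<And>j. has_weak_derivative (\<phi> j) (\<phi>' j)) \<Longrightarrow>
        (\<Sum>j\<in>UNIV. let c = slice (X j) t in
            curve_inner c (\<lambda>r. d_t (X j) r t \<bullet> normal c r) (\<phi> j)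
          + curve_inner c (per_arclength c (\<mu>' j)) (per_arclength c (\<phi>' j))) = 0"
    and weak_potential:
      "\<And>t \<omega> \<omega>'.
        t > 0 \<Longrightarrow> \<omega> \<in> V_space \<Longrightarrow> (\<And>j. has_weak_derivative (\<omega> j) (\<omega>' j)) \<Longrightarrow>
        (\<Sum>j\<in>UNIV. let c = slice (X j) t in
            curve_inner c (\<lambda>r. \<mu> j r t *\<^sub>R normal c r) (\<omega> j)
          - curve_inner c (\<lambda>r. Z_matrix (\<gamma> j) (K j) (normal c r) *v d_s c c r)
              (per_arclength c (\<omega>' j)))
        - (1 / \<eta> 1 * deriv (contact X 1) t + \<sigma>1) * \<omega> 1 0 $ 1
        - (1 / \<eta> 2 * deriv (contact X 2) t - \<sigma>2) * \<omega> 2 0 $ 1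
        - (1 / \<eta> 3 * deriv (contact X 3) t + \<sigma>2 - \<sigma>1) * \<omega> 3 0 $ 1 = 0"
  shows "(\<forall>t\<ge>0. total_area X t = total_area X 0) \<and>
    (\<forall>t1 t2. t1 \<ge> t2 \<and> t2 \<ge> 0 \<longrightarrow>
       total_energy \<gamma> \<sigma>1 \<sigma>2 X t1 \<le> total_energy \<gamma> \<sigma>1 \<sigma>2 X t2 \<and>
       total_energy \<gamma> \<sigma>1 \<sigma>2 X t2 \<le> total_energy \<gamma> \<sigma>1 \<sigma>2 X 0)"
proof -
  \<comment> \<open>Moving the scalar to the other factor makes the term of the second equation with
    the velocity as test function equal to the term of the first with \<mu> as test
    function.\<close>
  have normal_velocity_inner:
    "curve_inner c (\<lambda>r. m r *\<^sub>R n r) v = curve_inner c (\<lambda>r. v r \<bullet> n r) m"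
    for c m and n v :: "real \<Rightarrow> real^2"
    by (simp add: curve_inner_def inner_commute mult.commute)
  have weak: "\<exists>\<mu>'. \<forall>j. has_weak_derivative (\<psi> j) (\<mu>' j)" if "\<psi> \<in> W_space" for \<psi>
    using that by (intro choice) (simp add: W_space_def H1_unit_def)

  have contact_deriv: "(contact X j has_real_derivative d_t (X j) 0 t $ 1) (at t)" if "t > 0" for j t
    using bounded_linear.has_vector_derivative[OF bounded_linear_vec_nth[of 1]
        time_has_vector_derivative[OF regular that, of 0 j]]
    by (simp add: has_real_derivative_iff_has_vector_derivative contact_def[abs_def])
  have contact_cont: "continuous_on {0..} (contact X j)" for j
    using continuous_on_slice2[of "{0..1}" "{0..}" "X j" 0] regular_evolution_continuous(1)[OF regular, of j]
    unfolding contact_def[abs_def] by (auto simp: split_beta intro!: continuous_intros)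

  \<comment> \<open>Conservation of area\<close>
  have flux: "curve_integral (slice (X 1) t) (\<lambda>r. d_t (X 1) r t \<bullet> normal (slice (X 1) t) r)
      = curve_integral (slice (X 2) t) (\<lambda>r. d_t (X 2) r t \<bullet> normal (slice (X 2) t) r)"
    if t: "t > 0" for t
  proof -
    \<comment> \<open>The end values sum to zero, so these constants are admissible, and their zero
      derivative removes the diffusion term.\<close>
    define a :: "3 \<Rightarrow> real" where "a = (\<lambda>j. if j = 1 then 1 else if j = 2 then - 1 else 0)"
    obtain \<mu>' where \<mu>': "\<And>j. has_weak_derivative (slice (\<mu> j) t) (\<mu>' j)"
      using weak[OF mu_in_W[OF t]] by auto
    have "(\<lambda>j r. a j) \<in> W_space"
      by (simp add: W_space_def H1_unit_const sum_3 a_def)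
    moreover have "has_weak_derivative (\<lambda>r. a j) (\<lambda>r. 0)" for j
      by (rule has_weak_derivative_classical) auto
    ultimately have "(\<Sum>j\<in>UNIV. let c = slice (X j) t in
            curve_inner c (\<lambda>r. d_t (X j) r t \<bullet> normal c r) (\<lambda>r. a j)
          + curve_inner c (per_arclength c (\<mu>' j)) (per_arclength c (\<lambda>r. 0))) = 0"
      by (intro weak_velocity[OF t \<mu>'])
    then show ?thesis
      by (simp add: Let_def sum_3 a_def curve_inner_def per_arclength_def curve_integral_def
          set_lebesgue_integral_def)
  qed

  have area: "total_area X t = total_area X 0" if "t \<ge> 0" for t
  proof (cases "t = 0")
    case False
    show ?thesis
    proof (rule DERIV_isconst_end[where f = "total_area X"])
      show "0 < t" using that False by simp
      show "continuous_on {0..t} (total_area X)"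
        unfolding total_area_def[abs_def]
        by (intro continuous_intros continuous_on_subset[OF continuous_on_area_under[OF regular]]) auto
      fix s assume s: "0 < s" "s < t"
      \<comment> \<open>The boundary terms at the substrate vanish; those at the triple point cancel
        because positions and velocities of the curves agree there.\<close>
      have "X j 0 s $ 2 = 0" for j
        using X_in_V[of s] s by (simp add: V_space_def slice_def)
      moreover have "X 1 1 s = X 2 1 s" "d_t (X 1) 1 s = d_t (X 2) 1 s"
        using X_in_V[of s] dtX_in_V[of s] s by (simp_all add: V_space_def slice_def)
      ultimately show "(total_area X has_real_derivative 0) (at s)"
        unfolding total_area_def[abs_def]
        using DERIV_diff[OF area_under_has_derivative[OF regular s(1), of 2]
            area_under_has_derivative[OF regular s(1), of 1]] flux[OF s(1)]
        by simp
    qed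
  qed simp

  \<comment> \<open>Dissipation of energy\<close>
  have energy_deriv: "\<exists>D. (total_energy \<gamma> \<sigma>1 \<sigma>2 X has_real_derivative D) (at t) \<and> D \<le> 0"
    if t: "t > 0" for t
  proof -
    obtain \<mu>' where \<mu>': "\<And>j. has_weak_derivative (slice (\<mu> j) t) (\<mu>' j)"
      using weak[OF mu_in_W[OF t]] by auto
    \<comment> \<open>\<open>P\<close> is the term shared by both equations, \<open>Q\<close> the
      diffusive dissipation, \<open>R\<close> the rate of the surface energy, and \<open>x'\<close>
      the contact point velocities.\<close>
    define P where "P j = curve_inner (slice (X j) t)
      (\<lambda>r. d_t (X j) r t \<bullet> normal (slice (X j) t) r) (slice (\<mu> j) t)" for j
    define Q where "Q j = curve_inner (slice (X j) t)
      (per_arclength (slice (X j) t) (\<mu>' j)) (per_arclength (slice (X j) t) (\<mu>' j))" for j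
    define R where "R j = curve_inner (slice (X j) t)
      (\<lambda>r. Z_matrix (\<gamma> j) (K j) (normal (slice (X j) t) r) *v d_s (slice (X j) t) (slice (X j) t) r)
      (per_arclength (slice (X j) t) (d_rho (slice (d_t (X j)) t)))" for j
    define x' where "x' j = d_t (X j) 0 t $ 1" for j
    have PQ: "(\<Sum>j\<in>UNIV. P j + Q j) = 0"
      using weak_velocity[OF t \<mu>' mu_in_W[OF t] \<mu>'] by (simp add: Let_def P_def Q_def)
    \<comment> \<open>Testing with the velocity makes the test value at each contact point equal to
      the contact velocity itself, which produces squares.\<close>
    have "(\<Sum>j\<in>UNIV. P j - R j) - (1 / \<eta> 1 * x' 1 + \<sigma>1) * x' 1
        - (1 / \<eta> 2 * x' 2 - \<sigma>2) * x' 2 - (1 / \<eta> 3 * x' 3 + \<sigma>2 - \<sigma>1) * x' 3 = 0"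
      using weak_potential[OF t dtX_in_V[OF t] has_weak_derivative_velocity[OF regular t]]
      by (simp add: Let_def normal_velocity_inner P_def R_def x'_def slice_def
          DERIV_imp_deriv[OF contact_deriv[OF t]])
    \<comment> \<open>Eliminating \<open>P\<close> between the two equations; the terms with
      \<sigma>1 and \<sigma>2 are exactly those of the energy rate and cancel.\<close>
    with PQ have R: "(\<Sum>j\<in>UNIV. R j) - \<sigma>1 * (x' 3 - x' 1) - \<sigma>2 * (x' 2 - x' 3)
        = - (\<Sum>j\<in>UNIV. Q j + (x' j)\<^sup>2 / \<eta> j)"
      by (simp add: sum_3 algebra_simps power2_eq_square)
    \<comment> \<open>The integrand is a square times the speed; a nonintegrable one would give the
      default value 0, so the sign holds in every case.\<close>
    have "Q j \<ge> 0" for j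
      unfolding Q_def curve_inner_def curve_integral_def set_lebesgue_integral_def
      by (intro Bochner_Integration.integral_nonneg) (simp add: speed_def indicator_def)
    then have "(\<Sum>j\<in>UNIV. Q j + (x' j)\<^sup>2 / \<eta> j) \<ge> 0"
      using eta_pos by (intro sum_nonneg add_nonneg_nonneg divide_nonneg_pos) auto
    moreover have "(total_energy \<gamma> \<sigma>1 \<sigma>2 X has_real_derivative
        (\<Sum>j\<in>UNIV. R j) - \<sigma>1 * (x' 3 - x' 1) - \<sigma>2 * (x' 2 - x' 3)) (at t)"
      unfolding total_energy_def[abs_def] R_def x'_def
      by (intro DERIV_diff DERIV_sum DERIV_cmult contact_deriv[OF t]
          surface_energy_has_derivative[OF regular gamma_C2 t])
    ultimately show ?thesis
      unfolding R by auto
  qed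

  have energy: "total_energy \<gamma> \<sigma>1 \<sigma>2 X t1 \<le> total_energy \<gamma> \<sigma>1 \<sigma>2 X t2" if "t2 \<ge> 0" "t1 \<ge> t2" for t1 t2
  proof (rule DERIV_nonpos_imp_decreasing_open[where f = "total_energy \<gamma> \<sigma>1 \<sigma>2 X"])
    show "continuous_on {t2..t1} (total_energy \<gamma> \<sigma>1 \<sigma>2 X)"
      unfolding total_energy_def[abs_def]
      by (rule continuous_on_subset[where s = "{0..}"])
        (intro continuous_intros continuous_on_surface_energy[OF regular gamma_C2] contact_cont,
          use that in auto)
  qed (use that energy_deriv in auto)
  \<comment> \<open>The comparison with the initial energy is the monotonicity between
    \<open>t2\<close> and 0.\<close>
  show ?thesis
    using area energy by blast
qed

end
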